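(* For a fixed total field $u$, the operator $G:C^2([0,\pi]\times[0,2\pi])\to C([0,\pi]\times[0,2\pi])$, $G(z)=\nu(z)\cdot\nabla u(z)$, is Fréchet differentiable and its derivative is given by $$G'(z)h=\frac{1}{|z_\theta\times z_\phi|}\Big((I-\nu\nu^\top)(h_\theta\times z_\phi+z_\theta\times h_\phi)\Big)\cdot\nabla u+\nu\cdot(\nabla\nabla^\top u\,h),$$ where $I$ is the $3\times3$ identity matrix, $h_\theta=\partial h/\partial\theta$ and $h_\phi=\partial h/\partial\phi$.
   Context: Total field: $D\subset\mathbb{R}^3$ is a bounded Lipschitz domain with connected complement $\mathbb{R}^3\setminus\overline D$ (a sound-hard obstacle), $k>0$ is a wavenumber, $u^i(x)=\mathrm{e}^{\mathrm{i}kx\cdot d}$ is an incident plane wave with direction $d$ in the unit sphere, and $u=u^i+u^s$ is the total field, i.e. the solution of $\Delta u+k^2u=0$ in $\mathbb{R}^3\setminus\overline D$ with zero normal derivative on $\partial D$ and with the scattered field $u^s$ satisfying the Sommerfeld radiation condition $\lim_{r\to\infty}r(\partial u^s/\partial r-\mathrm{i}ku^s)=0$, $r=|x|$, uniformly in all directions. Surfaces: $\gamma=\{z(\theta,\phi):(\theta,\phi)\in[0,\pi]\times[0,2\pi]\}$ is a closed surface in $\mathbb{R}^3$, the boundary of a bounded domain, with parameterization $z$, and is identified with $z$. The shift $h$ is an $\mathbb{R}^3$-valued function of $(\theta,\phi)$. Write $z_\theta=\partial z/\partial\theta$ and $z_\phi=\partial z/\partial\phi$. The normal vector is $\nu=\dfrac{z_\theta\times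 z_\phi}{|z_\theta\times z_\phi|}$. Operator: for the fixed total field $u$, $G$ maps the boundary surface $\gamma$ onto the trace of $\partial u/\partial\nu$ on $\gamma$, that is, $G(z)=\nu(z)\cdot\nabla u(z)$. $\nabla\nabla^\top u$ is the Hessian matrix of $u$; in the formula for $G'(z)h$, $\nu$, $\nabla u$ and $\nabla\nabla^\top u$ are taken at $z$. *)

theory Defs
  imports "HOL-Analysis.Analysis"
begin

text \<open>
  Complex-valued fields on \<open>\<real>\<^sup>3\<close>. The product \<open>bdot\<close> is bilinear (no conjugation), unlike
  the library's inner product, which is moreover real-valued on \<^typ>\<open>complex ^ 3\<close>.
\<close>

definition pdiff :: "3 \<Rightarrow> (real ^ 3 \<Rightarrow> complex) \<Rightarrow> real ^ 3 \<Rightarrow> complex" where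
  "pdiff j u x = frechet_derivative u (at x) (axis j 1)"

definition grad :: "(real ^ 3 \<Rightarrow> complex) \<Rightarrow> real ^ 3 \<Rightarrow> complex ^ 3" where
  "grad u x = (\<chi> j. pdiff j u x)"

definition hess :: "(real ^ 3 \<Rightarrow> complex) \<Rightarrow> real ^ 3 \<Rightarrow> complex ^ 3 ^ 3" where
  "hess u x = (\<chi> i j. pdiff i (pdiff j u) x)"

definition laplacian :: "(real ^ 3 \<Rightarrow> complex) \<Rightarrow> real ^ 3 \<Rightarrow> complex" where
  "laplacian u x = (\<Sum>j\<in>UNIV. pdiff j (pdiff j u) x)"

definition bdot :: "complex ^ 3 \<Rightarrow> complex ^ 3 \<Rightarrow> complex" where
  "bdot a b = (\<Sum>j\<in>UNIV. a $ j * b $ j)"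

definition cvec :: "real ^ 3 \<Rightarrow> complex ^ 3" where
  "cvec a = (\<chi> j. complex_of_real (a $ j))"

definition C1_on :: "(real ^ 3) set \<Rightarrow> (real ^ 3 \<Rightarrow> complex) \<Rightarrow> bool" where
  "C1_on S u \<longleftrightarrow> (\<forall>x\<in>S. u differentiable (at x)) \<and> (\<forall>j. continuous_on S (pdiff j u))"

definition C2_on :: "(real ^ 3) set \<Rightarrow> (real ^ 3 \<Rightarrow> complex) \<Rightarrow> bool" where
  "C2_on S u \<longleftrightarrow> C1_on S u \<and> (\<forall>j. C1_on S (pdiff j u))"

text \<open>
  Near each boundary point, in suitable orthonormal coordinates, a Lipschitz domain is the
  region above the graph of a Lipschitz function.
\<close>

definition bounded_lipschitz_domain :: "(real ^ 3) set \<Rightarrow> bool" where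
  "bounded_lipschitz_domain D \<longleftrightarrow> open D \<and> connected D \<and> D \<noteq> {} \<and> bounded D \<and>
     (\<forall>p\<in>frontier D. \<exists>(Q :: real ^ 3 \<Rightarrow> real ^ 3) (g :: real \<times> real \<Rightarrow> real) L r.
        orthogonal_transformation Q \<and> L-lipschitz_on UNIV g \<and> r > 0 \<and>
        (\<forall>x\<in>ball p r. x \<in> D \<longleftrightarrow> g (Q (x - p) $ 1, Q (x - p) $ 2) < Q (x - p) $ 3))"

definition exterior :: "(real ^ 3) set \<Rightarrow> (real ^ 3) set" where
  "exterior D = - closure D"

text \<open>
  On a Lipschitz boundary the normal exists only almost everywhere, so the homogeneous
  Neumann condition is the vanishing of the normal derivative defined through Green's first
  identity, for a field that is \<open>H\<^sup>1\<close> on the bounded parts of the exterior.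
\<close>

definition zero_normal_derivative :: "(real ^ 3) set \<Rightarrow> (real ^ 3 \<Rightarrow> complex) \<Rightarrow> bool" where
  "zero_normal_derivative D u \<longleftrightarrow>
     (\<forall>r. set_integrable lebesgue (exterior D \<inter> ball 0 r) (\<lambda>x. (norm (u x))\<^sup>2) \<and>
          set_integrable lebesgue (exterior D \<inter> ball 0 r) (\<lambda>x. (norm (grad u x))\<^sup>2)) \<and>
     (\<forall>v. C1_on UNIV v \<and> bounded {x. v x \<noteq> 0} \<longrightarrow>
        (LINT x:exterior D|lebesgue. bdot (grad u x) (grad v x) + laplacian u x * v x) = 0)"

text \<open>The radial derivative is \<open>(x / |x|) \<cdot> \<nabla>u\<close>.\<close>

definition sommerfeld :: "real \<Rightarrow> (real ^ 3 \<Rightarrow> complex) \<Rightarrow> bool" where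
  "sommerfeld k u \<longleftrightarrow>
     (\<forall>\<epsilon>>0. \<exists>R. \<forall>x. norm x \<ge> R \<longrightarrow>
        norm (complex_of_real (norm x) *
          (bdot (cvec (x /\<^sub>R norm x)) (grad u x) - \<i> * complex_of_real k * u x)) < \<epsilon>)"

definition plane_wave :: "real \<Rightarrow> real ^ 3 \<Rightarrow> real ^ 3 \<Rightarrow> complex" where
  "plane_wave k d x = exp (\<i> * complex_of_real (k * (x \<bullet> d)))"

definition total_field ::
    "(real ^ 3) set \<Rightarrow> real \<Rightarrow> real ^ 3 \<Rightarrow> (real ^ 3 \<Rightarrow> complex) \<Rightarrow> bool" where
  "total_field D k d u \<longleftrightarrow>
     C2_on (exterior D) u \<and>
     (\<forall>x\<in>exterior D. laplacian u x + (complex_of_real k)\<^sup>2 * u x = 0) \<and>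
     zero_normal_derivative D u \<and>
     sommerfeld k (\<lambda>x. u x - plane_wave k d x)"

text \<open>
  Functions on the parameter rectangle are total functions of which only the values on
  \<open>rect\<close> matter; on its sides the partial derivatives are one-sided.
\<close>

definition rect :: "(real \<times> real) set" where
  "rect = {0..pi} \<times> {0..2 * pi}"

definition dtheta :: "(real \<times> real \<Rightarrow> real ^ 3) \<Rightarrow> real \<times> real \<Rightarrow> real ^ 3" where
  "dtheta z p = vector_derivative (\<lambda>s. z (s, snd p)) (at (fst p) within {0..pi})"

definition dphi :: "(real \<times> real \<Rightarrow> real ^ 3) \<Rightarrow> real \<times> real \<Rightarrow> real ^ 3" where
  "dphi z p = vector_derivative (\<lambda>t. z (fst p, t)) (at (snd p) within {0..2 * pi})"

definition C1_rect :: "(real \<times> real \<Rightarrow> real ^ 3) set" where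
  "C1_rect = {z. continuous_on rect z \<and>
     (\<forall>p\<in>rect. (\<lambda>s. z (s, snd p)) differentiable (at (fst p) within {0..pi}) \<and>
               (\<lambda>t. z (fst p, t)) differentiable (at (snd p) within {0..2 * pi})) \<and>
     continuous_on rect (dtheta z) \<and> continuous_on rect (dphi z)}"

definition C2_rect :: "(real \<times> real \<Rightarrow> real ^ 3) set" where
  "C2_rect = {z \<in> C1_rect. dtheta z \<in> C1_rect \<and> dphi z \<in> C1_rect}"

definition sup_norm :: "(real \<times> real \<Rightarrow> 'b::real_normed_vector) \<Rightarrow> real" where
  "sup_norm f = (SUP p\<in>rect. norm (f p))"

definition C2_norm :: "(real \<times> real \<Rightarrow> real ^ 3) \<Rightarrow> real" where
  "C2_norm z = sup_norm z + sup_norm (dtheta z) + sup_norm (dphi z)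
     + sup_norm (dtheta (dtheta z)) + sup_norm (dtheta (dphi z))
     + sup_norm (dphi (dtheta z)) + sup_norm (dphi (dphi z))"

text \<open>
  Poles. A parameterization such as that of the sphere in spherical coordinates collapses the
  sides \<open>\<theta> = 0\<close> and \<open>\<theta> = \<pi>\<close> to points, where \<open>z\<^sub>\<phi>\<close>, hence \<open>z\<^sub>\<theta> \<times> z\<^sub>\<phi>\<close>, vanishes. The set
  \<open>E \<subseteq> {0, \<pi>}\<close> lists the sides that are collapsed. For \<open>E = {}\<close> the space \<open>C2_space E\<close> is the
  whole of \<open>C\<^sup>2(rect)\<close> and \<open>regular E z\<close> says that \<open>z\<^sub>\<theta> \<times> z\<^sub>\<phi>\<close> has no zero on \<open>rect\<close>.
  At a collapsed side, \<open>z\<^sub>\<theta> \<times> z\<^sub>\<phi>\<close> vanishes to first order exactly if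
  \<open>z\<^sub>\<theta> \<times> \<partial>z\<^sub>\<phi>/\<partial>\<theta> \<noteq> 0\<close>, and then the normal extends continuously to that side.
\<close>

definition C2_space :: "real set \<Rightarrow> (real \<times> real \<Rightarrow> real ^ 3) set" where
  "C2_space E = {h \<in> C2_rect. \<forall>p\<in>rect. fst p \<in> E \<longrightarrow> dphi h p = 0}"

definition nvec :: "(real \<times> real \<Rightarrow> real ^ 3) \<Rightarrow> real \<times> real \<Rightarrow> real ^ 3" where
  "nvec z p = cross3 (dtheta z p) (dphi z p)"

definition regular :: "real set \<Rightarrow> (real \<times> real \<Rightarrow> real ^ 3) \<Rightarrow> bool" where
  "regular E z \<longleftrightarrow>
     (\<forall>p\<in>rect. if fst p \<in> E then cross3 (dtheta z p) (dtheta (dphi z) p) \<noteq> 0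
               else nvec z p \<noteq> 0)"

definition surfaces :: "(real ^ 3) set \<Rightarrow> real set \<Rightarrow> (real \<times> real \<Rightarrow> real ^ 3) set" where
  "surfaces D E = {z \<in> C2_space E. regular E z \<and> z ` rect \<subseteq> exterior D}"

definition closed_surface :: "(real \<times> real \<Rightarrow> real ^ 3) \<Rightarrow> bool" where
  "closed_surface z \<longleftrightarrow>
     (\<exists>\<Omega>. open \<Omega> \<and> connected \<Omega> \<and> \<Omega> \<noteq> {} \<and> bounded \<Omega> \<and> z ` rect = frontier \<Omega>)"

definition unit_normal :: "(real \<times> real \<Rightarrow> real ^ 3) \<Rightarrow> real \<times> real \<Rightarrow> real ^ 3" where
  "unit_normal z p = nvec z p /\<^sub>R norm (nvec z p)"

text \<open>Extension by continuity of an expression in the normal to the points where it degenerates.\<close>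

definition cont_ext ::
    "(real \<times> real \<Rightarrow> real ^ 3) \<Rightarrow> (real \<times> real \<Rightarrow> complex) \<Rightarrow> real \<times> real \<Rightarrow> complex" where
  "cont_ext z f p =
     (if nvec z p \<noteq> 0 then f p else Lim (at p within {q \<in> rect. nvec z q \<noteq> 0}) f)"

definition G :: "(real ^ 3 \<Rightarrow> complex) \<Rightarrow> (real \<times> real \<Rightarrow> real ^ 3) \<Rightarrow> real \<times> real \<Rightarrow> complex" where
  "G u z = cont_ext z (\<lambda>p. bdot (cvec (unit_normal z p)) (grad u (z p)))"

definition outer :: "real ^ 3 \<Rightarrow> real ^ 3 \<Rightarrow> real ^ 3 ^ 3" where
  "outer a b = (\<chi> i j. a $ i * b $ j)"

definition G_deriv ::
    "(real ^ 3 \<Rightarrow> complex) \<Rightarrow> (real \<times> real \<Rightarrow> real ^ 3) \<Rightarrow> (real \<times> real \<Rightarrow> real ^ 3)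
       \<Rightarrow> real \<times> real \<Rightarrow> complex" where
  "G_deriv u z h = cont_ext z (\<lambda>p.
     complex_of_real (1 / norm (nvec z p)) *
       bdot (cvec ((mat 1 - outer (unit_normal z p) (unit_normal z p)) *v
                   (cross3 (dtheta h p) (dphi z p) + cross3 (dtheta z p) (dphi h p))))
            (grad u (z p))
     + bdot (cvec (unit_normal z p)) (hess u (z p) *v cvec (h p)))"

text \<open>
  Frechet derivative at \<open>z\<close> of an operator \<open>F\<close> from a set \<open>U\<close>, a neighbourhood of \<open>z\<close> in the
  subspace \<open>X\<close> of \<open>C\<^sup>2(rect)\<close>, to \<open>C(rect)\<close>. This is \<open>has_derivative\<close> written out for spaces
  of functions that are identified when they agree on \<open>rect\<close>.
\<close>

definition frechet_at ::
    "(real \<times> real \<Rightarrow> real ^ 3) set \<Rightarrow> (real \<times> real \<Rightarrow> real ^ 3) set \<Rightarrow>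
     ((real \<times> real \<Rightarrow> real ^ 3) \<Rightarrow> real \<times> real \<Rightarrow> complex) \<Rightarrow>
     ((real \<times> real \<Rightarrow> real ^ 3) \<Rightarrow> real \<times> real \<Rightarrow> complex) \<Rightarrow>
     (real \<times> real \<Rightarrow> real ^ 3) \<Rightarrow> bool" where
  "frechet_at X U F A z \<longleftrightarrow>
     z \<in> U \<and> (\<exists>\<delta>>0. \<forall>h\<in>X. C2_norm h < \<delta> \<longrightarrow> (\<lambda>p. z p + h p) \<in> U) \<and>
     (\<forall>w\<in>U. continuous_on rect (F w)) \<and>
     (\<forall>h\<in>X. continuous_on rect (A h)) \<and>
     (\<forall>h\<in>X. \<forall>h'\<in>X. \<forall>p\<in>rect. A (\<lambda>q. h q + h' q) p = A h p + A h' p) \<and>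
     (\<forall>h\<in>X. \<forall>c. \<forall>p\<in>rect. A (\<lambda>q. c *\<^sub>R h q) p = c *\<^sub>R A h p) \<and>
     (\<exists>B. \<forall>h\<in>X. sup_norm (A h) \<le> B * C2_norm h) \<and>
     (\<forall>\<epsilon>>0. \<exists>\<delta>>0. \<forall>h\<in>X. C2_norm h < \<delta> \<longrightarrow>
        sup_norm (\<lambda>p. F (\<lambda>q. z q + h q) p - F z p - A h p) \<le> \<epsilon> * C2_norm h)"

end

theory Submission
  imports Defs
begin

text \<open>
  The value of \<open>G(z)\<close> at a parameter \<open>p\<close> depends only on finitely many numbers attached to \<open>z\<close>
  at \<open>p\<close>. If no side of the rectangle is collapsed these are \<open>z\<close>, \<open>z\<^sub>\<theta>\<close> and \<open>z\<^sub>\<phi>\<close>, and \<open>G(z)\<close>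
  is the superposition \<open>p \<mapsto> \<Psi> (z p, z\<^sub>\<theta> p, z\<^sub>\<phi> p)\<close> with
  \<open>\<Psi> (x, a, m) = sgn (a \<times> m) \<cdot> \<nabla>u x\<close>, called \<open>normal_trace u\<close> below. On the open set where \<open>x\<close> is exterior to \<open>D\<close> and
  \<open>a \<times> m \<noteq> 0\<close> this \<open>\<Psi>\<close> is continuously differentiable, because \<open>u\<close> is \<open>C\<^sup>2\<close> there, and its
  derivative is exactly the asserted formula (\<open>has_derivative_normal_trace\<close>). The jet of \<open>z\<close> sweeps
  out a compact set, on which the first-order expansion of \<open>\<Psi>\<close> is uniform
  (\<open>uniform_first_order_expansion\<close>); since the jet of \<open>h\<close> is linear in \<open>h\<close> and bounded by the
  \<open>C\<^sup>2\<close> norm of \<open>h\<close>, the Frechet derivative is obtained by inserting jets in \<open>\<Psi>'\<close>.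

  Along a collapsed side \<open>z\<^sub>\<phi>\<close> vanishes and the jet leaves the domain of \<open>\<Psi>\<close>. But \<open>\<Psi>\<close> is invariant
  under positive rescaling of \<open>m\<close>, so \<open>z\<^sub>\<phi>\<close> may be divided by a positive weight vanishing to first
  order at the collapsed sides. By the mean value formula in integral form the quotient is continuous
  up to those sides, linear in \<open>z\<close>, bounded by the \<open>C\<^sup>2\<close> norm, and equals \<open>\<plusminus>\<partial>z\<^sub>\<phi>/\<partial>\<theta>\<close> on them
  (\<open>dphi_quot\<close>). With this blown-up jet the regularity condition says precisely that the jet
  stays in the domain of \<open>\<Psi>\<close> (\<open>surfaces_iff_blowup_jet\<close>), and the extension by continuity in the
  definitions of \<open>G\<close> and its derivative is the superposition evaluated at the side
  (\<open>G_eq_normal_trace\<close>, \<open>G_deriv_eq_normal_trace_deriv\<close>).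
\<close>

section \<open>First-order expansion, uniformly on compact sets\<close>

text \<open>
  A closed tube around the compact set still lies in \<open>U\<close>; the derivative is uniformly continuous on it
  in operator norm, and the mean value inequality along segments turns this into one \<open>d\<close> for all base
  points.
\<close>

lemma uniform_first_order_expansion:
  fixes F :: "'a::euclidean_space \<Rightarrow> 'b::real_normed_vector"
  assumes U: "open U" and K: "compact K" "K \<subseteq> U"
    and der: "\<And>x. x \<in> U \<Longrightarrow> (F has_derivative F' x) (at x)"
    and cont: "\<And>i. i \<in> Basis \<Longrightarrow> continuous_on U (\<lambda>x. F' x i)"
    and e: "e > 0"
  obtains d where "d > 0"
    "\<And>x y. x \<in> K \<Longrightarrow> norm y < d \<Longrightarrow> x + y \<in> U"
    "\<And>x y. x \<in> K \<Longrightarrow> norm y < d \<Longrightarrow> norm (F (x + y) - F x - F' x y) \<le> e * norm y"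
proof -
  \<comment> \<open>Uniform continuity is needed for the operator norm, hence the passage to bounded linear maps.\<close>
  define B where "B x = Blinfun (F' x)" for x
  have B: "blinfun_apply (B x) = F' x" if "x \<in> U" for x
    using has_derivative_bounded_linear[OF der[OF that]] by (simp add: B_def bounded_linear_Blinfun_apply)
  have contB: "continuous_on U B"
    by (rule continuous_on_blinfun_componentwise)
       (use cont B in \<open>simp cong: continuous_on_cong\<close>)
  obtain r where r: "r > 0" "(\<Union>x\<in>K. cball x r) \<subseteq> U"
    using compact_subset_open_imp_cball_epsilon_subset[OF K(1) U K(2)] by blast
  have eq: "(\<Union>x\<in>K. cball x r) = {x + y | x y. x \<in> K \<and> y \<in> cball 0 r}"
  proof (intro set_eqI iffI)
    fix w assume "w \<in> (\<Union>x\<in>K. cball x r)"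
    then obtain x where "x \<in> K" "dist x w \<le> r" by auto
    then have "w = x + (w - x)" "w - x \<in> cball 0 r" by (auto simp: dist_norm norm_minus_commute)
    then show "w \<in> {x + y | x y. x \<in> K \<and> y \<in> cball 0 r}" using \<open>x \<in> K\<close> by blast
  next
    fix w assume "w \<in> {x + y | x y. x \<in> K \<and> y \<in> cball 0 r}"
    then obtain x y where "w = x + y" "x \<in> K" "norm y \<le> r" by auto
    then have "w \<in> cball x r" by (simp add: dist_norm)
    then show "w \<in> (\<Union>x\<in>K. cball x r)" using \<open>x \<in> K\<close> by blast
  qed
  have "compact (\<Union>x\<in>K. cball x r)"
    unfolding eq by (rule compact_sums[OF K(1) compact_cball])
  then have "uniformly_continuous_on (\<Union>x\<in>K. cball x r) B"
    using compact_uniformly_continuous continuous_on_subset[OF contB r(2)] by blast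
  then obtain d where d: "d > 0"
    "\<And>x y. x \<in> (\<Union>x\<in>K. cball x r) \<Longrightarrow> y \<in> (\<Union>x\<in>K. cball x r) \<Longrightarrow> dist y x < d \<Longrightarrow> dist (B y) (B x) < e"
    unfolding uniformly_continuous_on_def using e by metis
  show thesis
  proof (rule that[of "min d r"])
    show "min d r > 0" using d r by simp
  next
    fix x y :: 'a assume x: "x \<in> K" and y: "norm y < min d r"
    have ball: "ball x (min d r) \<subseteq> (\<Union>x\<in>K. cball x r)" using x by fastforce
    show "x + y \<in> U" using x y r by (fastforce simp: dist_norm)
    have "norm (F (x + y) - F x - F' x (x + y - x)) \<le> norm (x + y - x) * e"
    proof (rule differentiable_bound_linearization[where S = "ball x (min d r)"])
      fix t :: real assume t: "t \<in> {0..1}"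
      have "norm (t *\<^sub>R y) \<le> norm y" using t by (simp add: mult_left_le_one_le)
      then show "x + t *\<^sub>R (x + y - x) \<in> ball x (min d r)" using y by (simp add: dist_norm)
    next
      fix w assume w: "w \<in> ball x (min d r)"
      then have wU: "w \<in> U" using ball r by blast
      show "(F has_derivative F' w) (at w within ball x (min d r))"
        using der[OF wU] by (rule has_derivative_at_withinI)
      have "dist (B w) (B x) < e"
        using w ball x y r by (intro d) (auto simp: dist_commute intro!: bexI[of _ x])
      moreover have "F' w - F' x = blinfun_apply (B w - B x)"
        using B[OF wU] B[OF subsetD[OF K(2) x]] by (simp add: blinfun.diff_left fun_eq_iff)
      ultimately show "onorm (F' w - F' x) \<le> e" by (simp add: dist_norm norm_blinfun.rep_eq)
    next
      show "x \<in> ball x (min d r)" using d r by simp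
    qed
    then show "norm (F (x + y) - F x - F' x y) \<le> e * norm y" by (simp add: mult.commute)
  qed
qed

lemma linear_eq_sum_Basis:
  fixes f :: "'a::euclidean_space \<Rightarrow> 'b::real_vector"
  assumes "linear f"
  shows "f y = (\<Sum>i\<in>Basis. (y \<bullet> i) *\<^sub>R f i)"
  using linear_sum[OF assms, of "\<lambda>i. (y \<bullet> i) *\<^sub>R i" Basis] linear_scale[OF assms]
  by (simp add: euclidean_representation)

lemma derivative_bounded_on_compact:
  fixes F' :: "'a::euclidean_space \<Rightarrow> 'a \<Rightarrow> 'b::real_normed_vector"
  assumes K: "compact K"
    and lin: "\<And>x. x \<in> K \<Longrightarrow> linear (F' x)"
    and cont: "\<And>i. i \<in> Basis \<Longrightarrow> continuous_on K (\<lambda>x. F' x i)"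
  obtains B where "B \<ge> 0" "\<And>x y. x \<in> K \<Longrightarrow> norm (F' x y) \<le> B * norm y"
proof -
  have "compact ((\<lambda>x. \<Sum>i\<in>Basis. norm (F' x i)) ` K)"
    by (intro compact_continuous_image K continuous_intros cont)
  then obtain B where B: "\<And>x. x \<in> K \<Longrightarrow> (\<Sum>i\<in>Basis. norm (F' x i)) \<le> B"
    unfolding compact_eq_bounded_closed bounded_iff by (auto simp: abs_le_iff)
  show thesis
  proof (rule that[of "max B 0"])
    fix x y :: 'a assume x: "x \<in> K"
    have "F' x y = (\<Sum>i\<in>Basis. (y \<bullet> i) *\<^sub>R F' x i)"
      by (rule linear_eq_sum_Basis[OF lin[OF x]])
    also have "norm \<dots> \<le> (\<Sum>i\<in>Basis. norm y * norm (F' x i))"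
      by (rule sum_norm_le) (simp add: Basis_le_norm mult_right_mono)
    also have "\<dots> \<le> max B 0 * norm y"
      using B[OF x] by (simp add: sum_distrib_left[symmetric] mult.commute mult_left_mono max.coboundedI1)
    finally show "norm (F' x y) \<le> max B 0 * norm y" .
  qed simp
qed

section \<open>Symmetry of second derivatives\<close>

text \<open>
  The second difference is the increment over \<open>[0, s]\<close> of \<open>t \<mapsto> f (x + t a + s b) - f (x + t a)\<close>,
  whose derivative is a first difference of \<open>y \<mapsto> f' y a\<close> and so close to \<open>s A b\<close> by
  differentiability of that map at the single point \<open>x\<close>.
\<close>

lemma second_difference_estimate:
  fixes f :: "'a::real_normed_vector \<Rightarrow> 'b::real_normed_vector"
  assumes S: "open S" "x \<in> S"
    and f: "\<And>y. y \<in> S \<Longrightarrow> (f has_derivative f' y) (at y)"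
    and A: "((\<lambda>y. f' y a) has_derivative A) (at x)"
    and e: "e > 0"
  obtains d where "d > 0"
    "\<And>s. 0 < s \<Longrightarrow> s < d \<Longrightarrow>
       norm (f (x + s *\<^sub>R a + s *\<^sub>R b) - f (x + s *\<^sub>R a) - f (x + s *\<^sub>R b) + f x - s\<^sup>2 *\<^sub>R A b) \<le> e * s\<^sup>2"
proof -
  \<comment> \<open>Every point of the parallelogram is within \<open>s * c\<close> of \<open>x\<close>; the summand 1 only keeps \<open>c\<close> positive.\<close>
  define c where "c = norm a + norm b + 1"
  have c: "c > 0" unfolding c_def by (simp add: add_nonneg_pos)
  obtain r where r: "r > 0" "ball x r \<subseteq> S" using S openE by blast
  have linA: "linear A" using A has_derivative_linear by blast
  have "e / (2 * c) > 0" using e c by simp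
  then obtain d0 where d0: "d0 > 0"
    "\<And>y. norm (y - x) < d0 \<Longrightarrow> norm (f' y a - f' x a - A (y - x)) \<le> e / (2 * c) * norm (y - x)"
    using A unfolding has_derivative_at_alt by metis
  define d where "d = min d0 r / c"
  show thesis
  proof (rule that[of d])
    show "d > 0" using d0 r c by (simp add: d_def)
  next
    fix s :: real assume s: "0 < s" "s < d"
    then have sc: "s * c < min d0 r" using c by (simp add: d_def pos_less_divide_eq)
    have small: "norm (t *\<^sub>R a + q *\<^sub>R b) \<le> s * c" if "t \<in> {0..s}" "q \<in> {0..s}" for t q
    proof -
      have "norm (t *\<^sub>R a + q *\<^sub>R b) \<le> t * norm a + q * norm b"
        using that by (intro norm_triangle_le) simp
      also have "\<dots> \<le> s * norm a + s * norm b" using that by (intro add_mono mult_right_mono) auto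
      also have "\<dots> \<le> s * c" using s by (simp add: c_def algebra_simps)
      finally show ?thesis .
    qed
    have inS: "x + t *\<^sub>R a + q *\<^sub>R b \<in> S" if "t \<in> {0..s}" "q \<in> {0..s}" for t q
    proof -
      have "x + (t *\<^sub>R a + q *\<^sub>R b) \<in> ball x r" 
        using small[OF that] sc unfolding mem_ball dist_commute[of x] unfolding dist_norm add_diff_cancel_left' by linarith
      then show ?thesis using r(2) by (auto simp: add.assoc)
    qed
    have near: "norm (f' (x + t *\<^sub>R a + q *\<^sub>R b) a - f' x a - A (t *\<^sub>R a + q *\<^sub>R b)) \<le> e / 2 * s"
      if "t \<in> {0..s}" "q \<in> {0..s}" for t q
    proof -
      have "norm (f' (x + t *\<^sub>R a + q *\<^sub>R b) a - f' x a - A (t *\<^sub>R a + q *\<^sub>R b))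
          \<le> e / (2 * c) * norm (t *\<^sub>R a + q *\<^sub>R b)"
        using d0(2)[of "x + t *\<^sub>R a + q *\<^sub>R b"] small[OF that] sc by (simp add: add.assoc)
      also have "\<dots> \<le> e / (2 * c) * (s * c)"
        using small[OF that] e c by (intro mult_left_mono) auto
      finally show ?thesis using c by simp
    qed
    define W where "W t = f (x + t *\<^sub>R a + s *\<^sub>R b) - f (x + t *\<^sub>R a) - t *\<^sub>R s *\<^sub>R A b" for t
    have "norm (W s - W 0) \<le> (e * s) * norm (s - 0)"
    proof (rule differentiable_bound[where S = "{0..s}"])
      fix t assume t: "t \<in> {0..s}"
      have s0: "s \<in> {0..s}" "(0::real) \<in> {0..s}" using s by auto
      have D: "((\<lambda>t. f (x + t *\<^sub>R a + q *\<^sub>R b)) has_derivative (\<lambda>h. f' (x + t *\<^sub>R a + q *\<^sub>R b) (h *\<^sub>R a))) (at t within {0..s})"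
        if "q \<in> {0..s}" for q
      proof -
        have "((\<lambda>t. x + t *\<^sub>R a + q *\<^sub>R b) has_derivative (\<lambda>h. h *\<^sub>R a)) (at t within {0..s})"
          by (auto intro!: derivative_eq_intros)
        from has_derivative_compose[OF this f[OF inS[OF t that]]] show ?thesis by (simp add: o_def)
      qed
      have D0: "((\<lambda>t. f (x + t *\<^sub>R a)) has_derivative (\<lambda>h. f' (x + t *\<^sub>R a) (h *\<^sub>R a))) (at t within {0..s})"
        using D[OF s0(2)] by simp
      have E: "(W has_derivative (\<lambda>h. f' (x + t *\<^sub>R a + s *\<^sub>R b) (h *\<^sub>R a) - f' (x + t *\<^sub>R a) (h *\<^sub>R a) - h *\<^sub>R s *\<^sub>R A b)) (at t within {0..s})"
        unfolding W_def by (intro has_derivative_diff D D0 s0) (auto intro!: derivative_eq_intros)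
      show "(W has_derivative (\<lambda>h. f' (x + t *\<^sub>R a + s *\<^sub>R b) (h *\<^sub>R a) - f' (x + t *\<^sub>R a) (h *\<^sub>R a) - h *\<^sub>R s *\<^sub>R A b)) (at t within {0..s})"
        by (rule E)
      have l: "f' (x + t *\<^sub>R a + q *\<^sub>R b) (h *\<^sub>R a) = h *\<^sub>R f' (x + t *\<^sub>R a + q *\<^sub>R b) a" if "q \<in> {0..s}" for q h
        using linear_scale[OF has_derivative_linear[OF f[OF inS[OF t that]]]] .
      define v where "v = f' (x + t *\<^sub>R a + s *\<^sub>R b) a - f' (x + t *\<^sub>R a) a - s *\<^sub>R A b"
      have "norm v \<le> e * s"
      proof -
        have "v = (f' (x + t *\<^sub>R a + s *\<^sub>R b) a - f' x a - A (t *\<^sub>R a + s *\<^sub>R b))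
                 - (f' (x + t *\<^sub>R a + 0 *\<^sub>R b) a - f' x a - A (t *\<^sub>R a + 0 *\<^sub>R b))"
          by (simp add: v_def linear_add[OF linA] linear_scale[OF linA])
        also have "norm \<dots> \<le> e / 2 * s + e / 2 * s"
          by (rule order.trans[OF norm_triangle_ineq4]) (intro add_mono near t s0)
        finally show ?thesis by simp
      qed
      moreover have "(\<lambda>h. f' (x + t *\<^sub>R a + s *\<^sub>R b) (h *\<^sub>R a) - f' (x + t *\<^sub>R a) (h *\<^sub>R a) - h *\<^sub>R s *\<^sub>R A b) = (\<lambda>h. h *\<^sub>R v)"
        using l[OF s0(1)] l[OF s0(2)] by (auto simp: v_def scaleR_diff_right)
      moreover have "onorm (\<lambda>h::real. h *\<^sub>R v) \<le> norm v"
        by (rule onorm_le) (simp add: mult.commute)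
      ultimately show "onorm (\<lambda>h. f' (x + t *\<^sub>R a + s *\<^sub>R b) (h *\<^sub>R a) - f' (x + t *\<^sub>R a) (h *\<^sub>R a) - h *\<^sub>R s *\<^sub>R A b) \<le> e * s"
        by simp
    qed (use s in auto)
    moreover have "W s - W 0 = f (x + s *\<^sub>R a + s *\<^sub>R b) - f (x + s *\<^sub>R a) - f (x + s *\<^sub>R b) + f x - s\<^sup>2 *\<^sub>R A b"
      by (simp add: W_def power2_eq_square)
    ultimately show "norm (f (x + s *\<^sub>R a + s *\<^sub>R b) - f (x + s *\<^sub>R a) - f (x + s *\<^sub>R b) + f x - s\<^sup>2 *\<^sub>R A b) \<le> e * s\<^sup>2"
      using s by (simp add: power2_eq_square mult.assoc)
  qed
qed

text \<open>
  The second difference is symmetric in \<open>a\<close> and \<open>b\<close>, while to order \<open>s\<^sup>2\<close> it is \<open>A b\<close> by one reading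
  and \<open>B a\<close> by the other.
\<close>

lemma second_derivative_symmetric:
  fixes f :: "'a::real_normed_vector \<Rightarrow> 'b::real_normed_vector"
  assumes S: "open S" "x \<in> S"
    and f: "\<And>y. y \<in> S \<Longrightarrow> (f has_derivative f' y) (at y)"
    and A: "((\<lambda>y. f' y a) has_derivative A) (at x)"
    and B: "((\<lambda>y. f' y b) has_derivative B) (at x)"
  shows "A b = B a"
proof -
  have "norm (A b - B a) \<le> 0 + e" if e: "e > 0" for e
  proof -
    have e2: "e / 2 > 0" using e by simp
    obtain d1 where d1: "d1 > 0" "\<And>s. 0 < s \<Longrightarrow> s < d1 \<Longrightarrow>
       norm (f (x + s *\<^sub>R a + s *\<^sub>R b) - f (x + s *\<^sub>R a) - f (x + s *\<^sub>R b) + f x - s\<^sup>2 *\<^sub>R A b) \<le> e / 2 * s\<^sup>2"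
      by (rule second_difference_estimate[OF S f A e2, where b = b]) auto
    obtain d2 where d2: "d2 > 0" "\<And>s. 0 < s \<Longrightarrow> s < d2 \<Longrightarrow>
       norm (f (x + s *\<^sub>R b + s *\<^sub>R a) - f (x + s *\<^sub>R b) - f (x + s *\<^sub>R a) + f x - s\<^sup>2 *\<^sub>R B a) \<le> e / 2 * s\<^sup>2"
      by (rule second_difference_estimate[OF S f B e2, where b = a]) auto
    define s where "s = min d1 d2 / 2"
    have s: "s > 0" "s < d1" "s < d2" using d1 d2 by (auto simp: s_def)
    let ?P = "f (x + s *\<^sub>R a + s *\<^sub>R b) - f (x + s *\<^sub>R a) - f (x + s *\<^sub>R b) + f x"
    have sw: "f (x + s *\<^sub>R b + s *\<^sub>R a) - f (x + s *\<^sub>R b) - f (x + s *\<^sub>R a) + f x = ?P"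
      by (simp add: algebra_simps)
    have "s\<^sup>2 *\<^sub>R (A b - B a) = (?P - s\<^sup>2 *\<^sub>R B a) - (?P - s\<^sup>2 *\<^sub>R A b)"
      by (simp add: algebra_simps)
    also have "norm \<dots> \<le> e / 2 * s\<^sup>2 + e / 2 * s\<^sup>2"
      by (rule order.trans[OF norm_triangle_ineq4])
         (use d1(2)[OF s(1,2)] d2(2)[OF s(1,3)] in \<open>auto simp: sw intro: add_mono\<close>)
    finally have "s\<^sup>2 * norm (A b - B a) \<le> s\<^sup>2 * e" by (simp add: mult.commute)
    then show ?thesis using s by simp
  qed
  then have "norm (A b - B a) \<le> 0" by (rule field_le_epsilon)
  then show ?thesis by simp
qed

section \<open>Calculus on the parameter rectangle\<close>

lemma rect_iff: "p \<in> rect \<longleftrightarrow> fst p \<in> {0..pi} \<and> snd p \<in> {0..2 * pi}"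
  by (cases p) (simp add: rect_def)

lemma compact_rect: "compact rect"
  unfolding rect_def by (intro compact_Times compact_Icc)

lemma zero_in_rect: "(0, 0) \<in> rect"
  by (simp add: rect_def)

lemma norm_le_sup_norm:
  assumes "continuous_on rect f" "p \<in> rect"
  shows "norm (f p) \<le> sup_norm f"
proof -
  have "compact ((\<lambda>p. norm (f p)) ` rect)"
    by (intro compact_continuous_image continuous_on_norm assms compact_rect)
  then show ?thesis
    unfolding sup_norm_def
    by (intro cSUP_upper assms bounded_imp_bdd_above compact_imp_bounded)
qed

lemma sup_norm_nonneg: "continuous_on rect f \<Longrightarrow> 0 \<le> sup_norm f"
  using norm_le_sup_norm[OF _ zero_in_rect] norm_ge_zero order.trans by blast

lemma sup_norm_le: "(\<And>p. p \<in> rect \<Longrightarrow> norm (f p) \<le> c) \<Longrightarrow> sup_norm f \<le> c"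
  unfolding sup_norm_def using zero_in_rect by (intro cSUP_least) auto

lemma dtheta_has_vector_derivative:
  assumes "f \<in> C1_rect" "p \<in> rect"
  shows "((\<lambda>s. f (s, snd p)) has_vector_derivative dtheta f p) (at (fst p) within {0..pi})"
  using assms unfolding C1_rect_def dtheta_def by (auto simp: vector_derivative_works)

lemma dphi_has_vector_derivative:
  assumes "f \<in> C1_rect" "p \<in> rect"
  shows "((\<lambda>t. f (fst p, t)) has_vector_derivative dphi f p) (at (snd p) within {0..2 * pi})"
  using assms unfolding C1_rect_def dphi_def by (auto simp: vector_derivative_works)

lemma dthetaI:
  assumes "((\<lambda>s. f (s, snd p)) has_vector_derivative v) (at (fst p) within {0..pi})" "p \<in> rect"
  shows "dtheta f p = v"
  using assms unfolding dtheta_def by (intro vector_derivative_within_closed_interval) (auto simp: rect_iff)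

lemma dphiI:
  assumes "((\<lambda>t. f (fst p, t)) has_vector_derivative v) (at (snd p) within {0..2 * pi})" "p \<in> rect"
  shows "dphi f p = v"
  using assms unfolding dphi_def by (intro vector_derivative_within_closed_interval) (auto simp: rect_iff)

lemma C1_rectI:
  assumes "continuous_on rect f" "continuous_on rect f1" "continuous_on rect f2"
    and 1: "\<And>p. p \<in> rect \<Longrightarrow> ((\<lambda>s. f (s, snd p)) has_vector_derivative f1 p) (at (fst p) within {0..pi})"
    and 2: "\<And>p. p \<in> rect \<Longrightarrow> ((\<lambda>t. f (fst p, t)) has_vector_derivative f2 p) (at (snd p) within {0..2 * pi})"
  shows "f \<in> C1_rect"
proof -
  have "continuous_on rect (dtheta f)" "continuous_on rect (dphi f)"
    using assms dthetaI[OF 1] dphiI[OF 2] by (simp_all cong: continuous_on_cong)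
  then show ?thesis
    using assms(1) differentiableI_vector[OF 1] differentiableI_vector[OF 2] by (auto simp: C1_rect_def)
qed

lemma C1_rect_continuous:
  assumes "f \<in> C1_rect"
  shows "continuous_on rect f" "continuous_on rect (dtheta f)" "continuous_on rect (dphi f)"
  using assms by (auto simp: C1_rect_def)

text \<open>
  The hypothesis on \<open>h\<close> is restricted to the rectangle so that the rule can be iterated: the
  partial derivatives of a combination agree with the combination of the partial derivatives there
  only.
\<close>

lemma C1_rect_lincomb:
  assumes f: "f \<in> C1_rect" and g: "g \<in> C1_rect"
    and h: "\<And>p. p \<in> rect \<Longrightarrow> h p = a *\<^sub>R f p + b *\<^sub>R g p"
  shows "h \<in> C1_rect"
    and "p \<in> rect \<Longrightarrow> dtheta h p = a *\<^sub>R dtheta f p + b *\<^sub>R dtheta g p"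
    and "p \<in> rect \<Longrightarrow> dphi h p = a *\<^sub>R dphi f p + b *\<^sub>R dphi g p"
proof -
  have 1: "((\<lambda>s. h (s, snd p)) has_vector_derivative a *\<^sub>R dtheta f p + b *\<^sub>R dtheta g p)
             (at (fst p) within {0..pi})" if p: "p \<in> rect" for p
  proof (rule has_vector_derivative_transform)
    show "((\<lambda>s. a *\<^sub>R f (s, snd p) + b *\<^sub>R g (s, snd p)) has_vector_derivative a *\<^sub>R dtheta f p + b *\<^sub>R dtheta g p)
             (at (fst p) within {0..pi})"
      using dtheta_has_vector_derivative[OF f p] dtheta_has_vector_derivative[OF g p]
      by (auto intro!: derivative_eq_intros)
  qed (use p h in \<open>auto simp: rect_iff\<close>)
  have 2: "((\<lambda>t. h (fst p, t)) has_vector_derivative a *\<^sub>R dphi f p + b *\<^sub>R dphi g p)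
             (at (snd p) within {0..2 * pi})" if p: "p \<in> rect" for p
  proof (rule has_vector_derivative_transform)
    show "((\<lambda>t. a *\<^sub>R f (fst p, t) + b *\<^sub>R g (fst p, t)) has_vector_derivative a *\<^sub>R dphi f p + b *\<^sub>R dphi g p)
             (at (snd p) within {0..2 * pi})"
      using dphi_has_vector_derivative[OF f p] dphi_has_vector_derivative[OF g p]
      by (auto intro!: derivative_eq_intros)
  qed (use p h in \<open>auto simp: rect_iff\<close>)
  have "continuous_on rect h"
    using h C1_rect_continuous[OF f] C1_rect_continuous[OF g]
    by (simp cong: continuous_on_cong add: continuous_intros)
  then show "h \<in> C1_rect"
    by (rule C1_rectI[where ?f1.0 = "\<lambda>p. a *\<^sub>R dtheta f p + b *\<^sub>R dtheta g p"
                        and ?f2.0 = "\<lambda>p. a *\<^sub>R dphi f p + b *\<^sub>R dphi g p"])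
       (intro continuous_intros C1_rect_continuous f g 1 2 | assumption)+
  show "p \<in> rect \<Longrightarrow> dtheta h p = a *\<^sub>R dtheta f p + b *\<^sub>R dtheta g p" by (intro dthetaI 1)
  show "p \<in> rect \<Longrightarrow> dphi h p = a *\<^sub>R dphi f p + b *\<^sub>R dphi g p" by (intro dphiI 2)
qed

lemma C2_rect_D:
  assumes "h \<in> C2_rect"
  shows "h \<in> C1_rect" "dtheta h \<in> C1_rect" "dphi h \<in> C1_rect"
  using assms by (auto simp: C2_rect_def)

lemma C2_spaceD:
  assumes "h \<in> C2_space E"
  shows "h \<in> C2_rect" "\<And>p. p \<in> rect \<Longrightarrow> fst p \<in> E \<Longrightarrow> dphi h p = 0"
  using assms by (auto simp: C2_space_def)

lemma C2_space_lincomb: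
  assumes f: "f \<in> C2_space E" and g: "g \<in> C2_space E"
  shows "(\<lambda>p. a *\<^sub>R f p + b *\<^sub>R g p) \<in> C2_space E"
proof -
  note F = C2_rect_D[OF C2_spaceD(1)[OF f]] and G = C2_rect_D[OF C2_spaceD(1)[OF g]]
  note lc = C1_rect_lincomb[OF F(1) G(1) refl, where a = a and b = b]
  show ?thesis
    using lc(1) C1_rect_lincomb(1)[OF F(2) G(2) lc(2)] C1_rect_lincomb(1)[OF F(3) G(3) lc(3)]
      C2_spaceD(2)[OF f] C2_spaceD(2)[OF g] lc(3)
    by (simp add: C2_space_def C2_rect_def)
qed

lemma norm_le_C2_norm:
  assumes h: "h \<in> C2_rect" and p: "p \<in> rect"
  shows "norm (h p) \<le> C2_norm h" "norm (dtheta h p) \<le> C2_norm h" "norm (dphi h p) \<le> C2_norm h"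
    "norm (dtheta (dphi h) p) \<le> C2_norm h"
proof -
  note H = C2_rect_D[OF h]
  note c = C1_rect_continuous[OF H(1)] C1_rect_continuous[OF H(2)] C1_rect_continuous[OF H(3)]
  show "norm (h p) \<le> C2_norm h" "norm (dtheta h p) \<le> C2_norm h" "norm (dphi h p) \<le> C2_norm h"
    "norm (dtheta (dphi h) p) \<le> C2_norm h"
    using c[THEN norm_le_sup_norm, OF p] c[THEN sup_norm_nonneg] unfolding C2_norm_def by linarith+
qed

lemma C2_norm_nonneg: "h \<in> C2_rect \<Longrightarrow> 0 \<le> C2_norm h"
  using norm_le_C2_norm(1)[OF _ zero_in_rect] norm_ge_zero order.trans by blast

section \<open>Division of the longitudinal derivative at collapsed sides\<close>

text \<open>
  The derivative \<open>h\<^sub>\<phi>\<close> multiplied by \<open>1 + (\<Sum>e\<in>E. 1 / \<bar>\<theta> - e\<bar>)\<close>, in a form that makes sense at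
  \<open>\<theta> = e\<close> as well: as \<open>h\<^sub>\<phi>\<close> vanishes at \<open>\<theta> = e\<close>, the integral is \<open>h\<^sub>\<phi> / (\<theta> - e)\<close>, and for
  \<open>e \<in> {0, pi}\<close> the factor \<open>cos e\<close> is the sign of \<open>\<theta> - e\<close> on the rectangle. A sum of reciprocals
  instead of the reciprocal of a product keeps the expression linear in \<open>h\<close> and of the same shape
  for each \<open>E\<close>.
\<close>

definition dphi_quot :: "real set \<Rightarrow> (real \<times> real \<Rightarrow> real ^ 3) \<Rightarrow> real \<times> real \<Rightarrow> real ^ 3" where
  "dphi_quot E h p = dphi h p +
     (\<Sum>e\<in>E. cos e *\<^sub>R integral {0..1} (\<lambda>t. dtheta (dphi h) (e + t * (fst p - e), snd p)))"

lemma segment_in_rect: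
  assumes "p \<in> rect" "e \<in> {0..pi}" "t \<in> {0..1}"
  shows "(e + t * (fst p - e), snd p) \<in> rect"
proof -
  have eq: "e + t * (fst p - e) = (1 - t) * e + t * fst p" by (simp add: algebra_simps)
  have "(1 - t) * e + t * fst p \<le> pi"
    using assms by (intro convex_bound_le) (auto simp: rect_iff)
  moreover have "0 \<le> (1 - t) * e + t * fst p"
    using assms by (auto simp: rect_iff intro!: add_nonneg_nonneg mult_nonneg_nonneg)
  ultimately show ?thesis using assms unfolding eq by (auto simp: rect_iff)
qed

lemma segment_integrand_continuous:
  assumes "continuous_on rect f" "p \<in> rect" "e \<in> {0..pi}"
  shows "continuous_on {0..1} (\<lambda>t. f (e + t * (fst p - e), snd p))"
  by (rule continuous_on_compose2[OF assms(1)])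
     (use segment_in_rect[OF assms(2,3)] in \<open>auto intro!: continuous_intros\<close>)

text \<open>
  The fundamental theorem of calculus on the segment from \<open>(e, \<phi>)\<close> to \<open>p\<close>.
\<close>

lemma segment_mean_value:
  assumes g: "g \<in> C1_rect" and p: "p \<in> rect" and e: "e \<in> {0..pi}"
  shows "(fst p - e) *\<^sub>R integral {0..1} (\<lambda>t. dtheta g (e + t * (fst p - e), snd p)) = g p - g (e, snd p)"
proof -
  have "((\<lambda>t. (fst p - e) *\<^sub>R dtheta g (e + t * (fst p - e), snd p)) has_integral
          (g (e + 1 * (fst p - e), snd p) - g (e + 0 * (fst p - e), snd p))) {0..1}"
  proof (rule fundamental_theorem_of_calculus)
    fix t :: real assume t: "t \<in> {0..1}"
    have "((\<lambda>s. g (s, snd p)) has_vector_derivative dtheta g (e + t * (fst p - e), snd p))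
            (at (e + t * (fst p - e)) within {0..pi})"
      using dtheta_has_vector_derivative[OF g segment_in_rect[OF p e t]] by (simp only: fst_conv snd_conv)
    then have "((\<lambda>s. g (s, snd p)) has_vector_derivative dtheta g (e + t * (fst p - e), snd p))
            (at (e + t * (fst p - e)) within (\<lambda>t. e + t * (fst p - e)) ` {0..1})"
      by (rule has_vector_derivative_within_subset)
         (use segment_in_rect[OF p e] in \<open>auto simp: rect_iff\<close>)
    moreover have "((\<lambda>t. e + t * (fst p - e)) has_vector_derivative (fst p - e)) (at t within {0..1})"
      by (auto intro!: derivative_eq_intros)
    ultimately show "((\<lambda>t. g (e + t * (fst p - e), snd p)) has_vector_derivative
        (fst p - e) *\<^sub>R dtheta g (e + t * (fst p - e), snd p)) (at t within {0..1})"
      using vector_diff_chain_within[of "\<lambda>t. e + t * (fst p - e)" "fst p - e" t "{0..1}" "\<lambda>s. g (s, snd p)"]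
      by (simp only: o_def)
  qed simp
  then have "integral {0..1} (\<lambda>t. (fst p - e) *\<^sub>R dtheta g (e + t * (fst p - e), snd p)) = g p - g (e, snd p)"
    by (intro integral_unique) simp
  then show ?thesis by simp
qed

context
  fixes E :: "real set"
  assumes E: "E \<subseteq> {0, pi}"
begin

lemma collapsed_side_facts: "finite E" "e \<in> E \<Longrightarrow> e \<in> {0..pi}"
  using E by (auto intro: finite_subset)

lemma dphi_quot_regular_side:
  assumes h: "h \<in> C2_space E" and p: "p \<in> rect" "fst p \<notin> E"
  shows "dphi_quot E h p = (1 + (\<Sum>e\<in>E. 1 / \<bar>fst p - e\<bar>)) *\<^sub>R dphi h p"
proof -
  note H = C2_rect_D[OF C2_spaceD(1)[OF h]]
  have "cos e *\<^sub>R integral {0..1} (\<lambda>t. dtheta (dphi h) (e + t * (fst p - e), snd p))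
      = (1 / \<bar>fst p - e\<bar>) *\<^sub>R dphi h p" if e: "e \<in> E" for e
  proof -
    let ?I = "integral {0..1} (\<lambda>t. dtheta (dphi h) (e + t * (fst p - e), snd p))"
    have I: "(fst p - e) *\<^sub>R ?I = dphi h p"
      using segment_mean_value[OF H(3) p(1) collapsed_side_facts(2)[OF e]] C2_spaceD(2)[OF h, of "(e, snd p)"] e p collapsed_side_facts(2)[OF e]
      by (simp add: rect_iff)
    have "cos e = (fst p - e) / \<bar>fst p - e\<bar>"
    proof (cases "e = 0")
      case True
      then have "fst p > 0" using e p by (auto simp: rect_iff order.order_iff_strict)
      then show ?thesis using True by simp
    next
      case False
      then have "e = pi" "fst p < pi" using e E p by (auto simp: rect_iff order.order_iff_strict)
      then show ?thesis by (simp add: nonzero_eq_divide_eq)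
    qed
    then show ?thesis by (simp flip: I)
  qed
  then show ?thesis by (simp add: dphi_quot_def scaleR_add_left scaleR_sum_left)
qed

text \<open>
  The integrand for \<open>e = \<theta>\<close> is constant. The integral belonging to the opposite side, when that
  side is collapsed too, is a difference quotient between two zeros of \<open>h\<^sub>\<phi>\<close>.
\<close>

lemma dphi_quot_collapsed_side:
  assumes h: "h \<in> C2_space E" and p: "p \<in> rect" "fst p \<in> E"
  shows "dphi_quot E h p = cos (fst p) *\<^sub>R dtheta (dphi h) p"
proof -
  note H = C2_rect_D[OF C2_spaceD(1)[OF h]]
  have "integral {0..1} (\<lambda>t. dtheta (dphi h) (e + t * (fst p - e), snd p)) = 0" if e: "e \<in> E - {fst p}" for e
    using segment_mean_value[OF H(3) p(1) collapsed_side_facts(2), of e] C2_spaceD(2)[OF h, of "(e, snd p)"]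
      C2_spaceD(2)[OF h p] e p collapsed_side_facts(2)[of e]
    by (auto simp: rect_iff)
  then have "(\<Sum>e\<in>E - {fst p}. cos e *\<^sub>R integral {0..1} (\<lambda>t. dtheta (dphi h) (e + t * (fst p - e), snd p))) = 0"
    by simp
  then show ?thesis
    using C2_spaceD(2)[OF h p] by (simp add: dphi_quot_def sum.remove[OF collapsed_side_facts(1) p(2)])
qed

lemma continuous_dphi_quot:
  assumes h: "h \<in> C2_rect"
  shows "continuous_on rect (dphi_quot E h)"
proof -
  note H = C2_rect_D[OF h]
  have "continuous_on rect (\<lambda>p. integral (cbox 0 1) (\<lambda>t. dtheta (dphi h) (e + t * (fst p - e), snd p)))"
    if e: "e \<in> E" for e
  proof (rule integral_continuous_on_param)
    show "continuous_on (rect \<times> cbox 0 1) (\<lambda>(p, t). dtheta (dphi h) (e + t * (fst p - e), snd p))"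
      unfolding case_prod_unfold
      by (rule continuous_on_compose2[OF C1_rect_continuous(2)[OF H(3)]])
         (use segment_in_rect[OF _ collapsed_side_facts(2)[OF e]] in \<open>auto intro!: continuous_intros\<close>)
  qed
  then show ?thesis
    unfolding dphi_quot_def using C1_rect_continuous(3)[OF H(1)] by (auto intro!: continuous_intros)
qed

lemma norm_dphi_quot_le:
  assumes h: "h \<in> C2_rect" and p: "p \<in> rect"
  shows "norm (dphi_quot E h p) \<le> (1 + card E) * C2_norm h"
proof -
  note H = C2_rect_D[OF h]
  have "norm (cos e *\<^sub>R integral {0..1} (\<lambda>t. dtheta (dphi h) (e + t * (fst p - e), snd p))) \<le> C2_norm h"
    if e: "e \<in> E" for e
  proof -
    have "norm (integral {0..1} (\<lambda>t. dtheta (dphi h) (e + t * (fst p - e), snd p))) \<le> C2_norm h * (1 - 0)"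
      by (rule integral_bound)
         (use segment_integrand_continuous[OF C1_rect_continuous(2)[OF H(3)] p collapsed_side_facts(2)[OF e]]
            norm_le_C2_norm(4)[OF h segment_in_rect[OF p collapsed_side_facts(2)[OF e]]] in auto)
    moreover have "\<bar>cos e\<bar> = 1" using E e by auto
    ultimately show ?thesis by simp
  qed
  then have "norm (dphi_quot E h p) \<le> C2_norm h + (\<Sum>e\<in>E. C2_norm h)"
    unfolding dphi_quot_def by (intro norm_triangle_mono norm_le_C2_norm sum_norm_le h p) auto
  then show ?thesis by (simp add: algebra_simps)
qed

lemma dphi_quot_lincomb:
  assumes f: "f \<in> C2_rect" and g: "g \<in> C2_rect" and p: "p \<in> rect"
  shows "dphi_quot E (\<lambda>p. a *\<^sub>R f p + b *\<^sub>R g p) p = a *\<^sub>R dphi_quot E f p + b *\<^sub>R dphi_quot E g p"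
proof -
  note F = C2_rect_D[OF f] and G = C2_rect_D[OF g]
  let ?h = "\<lambda>p. a *\<^sub>R f p + b *\<^sub>R g p"
  note lc = C1_rect_lincomb[OF F(1) G(1) refl, where a = a and b = b]
  note lc2 = C1_rect_lincomb(2)[OF F(3) G(3) lc(3)]
  let ?I = "\<lambda>h e. integral {0..1} (\<lambda>t. dtheta (dphi h) (e + t * (fst p - e), snd p))"
  have "?I ?h e = a *\<^sub>R ?I f e + b *\<^sub>R ?I g e" if e: "e \<in> E" for e
  proof -
    note int = integrable_continuous_interval[OF segment_integrand_continuous[OF C1_rect_continuous(2) p collapsed_side_facts(2)[OF e]]]
    have "?I ?h e = integral {0..1} (\<lambda>t. a *\<^sub>R dtheta (dphi f) (e + t * (fst p - e), snd p)
         + b *\<^sub>R dtheta (dphi g) (e + t * (fst p - e), snd p))"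
      by (intro integral_cong lc2 segment_in_rect p collapsed_side_facts(2)[OF e])
    also have "\<dots> = a *\<^sub>R ?I f e + b *\<^sub>R ?I g e"
      using int[OF F(3)] int[OF G(3)] by (simp add: integral_add integrable_cmul)
    finally show ?thesis .
  qed
  then show ?thesis
    using lc(3)[OF p]
    by (simp add: dphi_quot_def scaleR_add_right scaleR_sum_right sum.distrib mult.commute)
qed

end

section \<open>The normal derivative as a function of a jet\<close>

text \<open>
  Normalization sees only the part of the increment orthogonal to \<open>x\<close>; this is where the projection
  \<open>I - \<nu>\<nu>\<^sup>T\<close> comes from.
\<close>

lemma has_derivative_sgn:
  fixes x :: "'a::real_inner"
  assumes "x \<noteq> 0"
  shows "(sgn has_derivative (\<lambda>h. (1 / norm x) *\<^sub>R (h - (sgn x \<bullet> h) *\<^sub>R sgn x))) (at x)"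
proof -
  have "((\<lambda>y. inverse (norm y) *\<^sub>R y) has_derivative
      (\<lambda>h. inverse (norm x) *\<^sub>R h + (- (inverse (norm x) * (h \<bullet> sgn x) * inverse (norm x))) *\<^sub>R x)) (at x)"
    using assms by (intro derivative_intros has_derivative_norm) auto
  moreover have "(\<lambda>h. inverse (norm x) *\<^sub>R h + (- (inverse (norm x) * (h \<bullet> sgn x) * inverse (norm x))) *\<^sub>R x)
      = (\<lambda>h. (1 / norm x) *\<^sub>R (h - (sgn x \<bullet> h) *\<^sub>R sgn x))"
    by (auto simp: sgn_div_norm scaleR_diff_right inner_commute divide_inverse algebra_simps)
  ultimately show ?thesis unfolding sgn_div_norm[abs_def] by simp
qed

lemma outer_mult_vec: "outer a b *v w = (b \<bullet> w) *\<^sub>R a"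
  by (simp add: vec_eq_iff outer_def matrix_vector_mult_def inner_vec_def sum_distrib_left mult_ac)

lemma projection_mult_vec: "(mat 1 - outer a a) *v w = w - (a \<bullet> w) *\<^sub>R a"
  by (simp add: matrix_vector_mult_diff_rdistrib outer_mult_vec)

lemma cross3_bounded_bilinear: "bounded_bilinear cross3"
  using bilinear_cross bilinear_conv_bounded_bilinear by blast

type_synonym jet = "(real ^ 3) \<times> (real ^ 3) \<times> (real ^ 3)"

text \<open>
  The normal derivative \<open>\<nu> \<cdot> \<nabla>u\<close> at a point \<open>x\<close> of a surface with tangent vectors \<open>a\<close> and \<open>m\<close>.
\<close>

definition normal_trace :: "(real ^ 3 \<Rightarrow> complex) \<Rightarrow> jet \<Rightarrow> complex" where
  "normal_trace u = (\<lambda>(x, a, m). bdot (cvec (sgn (cross3 a m))) (grad u x))"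

definition normal_trace_deriv ::
    "(real ^ 3 \<Rightarrow> complex) \<Rightarrow> jet \<Rightarrow> jet \<Rightarrow> complex" where
  "normal_trace_deriv u = (\<lambda>(x, a, m) (y, b, l).
     let N = cross3 a m; \<nu> = sgn N in
     complex_of_real (1 / norm N) *
       bdot (cvec ((mat 1 - outer \<nu> \<nu>) *v (cross3 b m + cross3 a l))) (grad u x)
     + bdot (cvec \<nu>) (hess u x *v cvec y))"

definition jet_domain :: "(real ^ 3) set \<Rightarrow> jet set" where
  "jet_domain S = {(x, a, m). x \<in> S \<and> cross3 a m \<noteq> 0}"

lemma open_jet_domain:
  assumes "open S"
  shows "open (jet_domain S)"
proof -
  have "continuous_on UNIV (\<lambda>w::jet. cross3 (fst (snd w)) (snd (snd w)))"
    by (intro continuous_on_cross continuous_intros)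
  then have "open {w::jet. cross3 (fst (snd w)) (snd (snd w)) \<noteq> 0}"
    by (intro open_Collect_neq) auto
  moreover have "open {w::jet. fst w \<in> S}"
    using open_vimage_fst[OF assms] by (simp add: vimage_def)
  moreover have "jet_domain S = {w. fst w \<in> S} \<inter> {w. cross3 (fst (snd w)) (snd (snd w)) \<noteq> 0}"
    by (auto simp: jet_domain_def)
  ultimately show ?thesis by auto
qed

lemma has_derivative_pdiff:
  assumes "u differentiable (at x)"
  shows "(u has_derivative (\<lambda>y. \<Sum>j\<in>UNIV. complex_of_real (y $ j) * pdiff j u x)) (at x)"
proof -
  have D: "(u has_derivative frechet_derivative u (at x)) (at x)"
    using assms frechet_derivative_works by blast
  have "frechet_derivative u (at x) y = (\<Sum>j\<in>UNIV. complex_of_real (y $ j) * pdiff j u x)" for y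
  proof -
    have "y = (\<Sum>j\<in>UNIV. (y $ j) *\<^sub>R axis j 1)"
      using basis_expansion[of y] by (simp add: scalar_mult_eq_scaleR)
    then have "frechet_derivative u (at x) y = frechet_derivative u (at x) (\<Sum>j\<in>UNIV. (y $ j) *\<^sub>R axis j 1)"
      by (rule arg_cong)
    also have "\<dots> = (\<Sum>j\<in>UNIV. (y $ j) *\<^sub>R pdiff j u x)"
      unfolding linear_sum[OF has_derivative_linear[OF D]] linear_scale[OF has_derivative_linear[OF D]]
      by (simp only: pdiff_def)
    finally show ?thesis by (simp add: scaleR_conv_of_real)
  qed
  then have "frechet_derivative u (at x) = (\<lambda>y. \<Sum>j\<in>UNIV. complex_of_real (y $ j) * pdiff j u x)" ..
  then show ?thesis using D by simp
qed

lemma has_derivative_vec: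
  fixes f :: "'a::real_normed_vector \<Rightarrow> 'b::euclidean_space ^ 'n"
  assumes "\<And>j. ((\<lambda>x. f x $ j) has_derivative (\<lambda>y. f' y $ j)) (at a within S)"
  shows "(f has_derivative f') (at a within S)"
proof (subst has_derivative_componentwise_within, intro ballI)
  fix i :: "'b ^ 'n" assume "i \<in> Basis"
  then obtain b j where "i = axis j b" by (auto simp: Basis_vec_def)
  then show "((\<lambda>x. f x \<bullet> i) has_derivative (\<lambda>x. f' x \<bullet> i)) (at a within S)"
    using has_derivative_inner_left[OF assms[of j], of b] by (simp add: inner_axis)
qed

lemma C2_onD:
  assumes "C2_on S u"
  shows "x \<in> S \<Longrightarrow> u differentiable (at x)" "continuous_on S (pdiff j u)"
    "x \<in> S \<Longrightarrow> pdiff j u differentiable (at x)" "continuous_on S (pdiff i (pdiff j u))"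
  using assms by (auto simp: C2_on_def C1_on_def)

lemma pdiff_commute:
  assumes u: "C2_on S u" and S: "open S" "x \<in> S"
  shows "pdiff i (pdiff j u) x = pdiff j (pdiff i u) x"
proof -
  let ?f' = "\<lambda>y. frechet_derivative u (at y)"
  have "frechet_derivative (pdiff j u) (at x) (axis i 1) = frechet_derivative (pdiff i u) (at x) (axis j 1)"
  proof (rule second_derivative_symmetric[OF S, of u ?f'])
    show "(u has_derivative ?f' y) (at y)" if "y \<in> S" for y
      using C2_onD(1)[OF u that] frechet_derivative_works by blast
    show "((\<lambda>y. ?f' y (axis j 1)) has_derivative frechet_derivative (pdiff j u) (at x)) (at x)"
      "((\<lambda>y. ?f' y (axis i 1)) has_derivative frechet_derivative (pdiff i u) (at x)) (at x)"
      using C2_onD(3)[OF u S(2)] unfolding frechet_derivative_works pdiff_def[abs_def] by auto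
  qed
  then show ?thesis by (simp add: pdiff_def)
qed

text \<open>
  The rows of \<open>hess u x\<close> are indexed by the variable of the outer derivative, so that as the
  derivative of the gradient one obtains its transpose; symmetry of the second derivatives makes the two
  equal.
\<close>

lemma has_derivative_grad:
  assumes u: "C2_on S u" and S: "open S" "x \<in> S"
  shows "(grad u has_derivative (\<lambda>y. hess u x *v cvec y)) (at x)"
proof -
  have "((\<lambda>x. \<chi> j. pdiff j u x) has_derivative
      (\<lambda>y. \<chi> j. \<Sum>i\<in>UNIV. complex_of_real (y $ i) * pdiff i (pdiff j u) x)) (at x)"
    by (rule has_derivative_vec) (simp add: has_derivative_pdiff[OF C2_onD(3)[OF u S(2)]])
  moreover have "(\<lambda>y. \<chi> j. \<Sum>i\<in>UNIV. complex_of_real (y $ i) * pdiff i (pdiff j u) x) = (\<lambda>y. hess u x *v cvec y)"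
    by (auto simp: fun_eq_iff vec_eq_iff matrix_vector_mult_def hess_def cvec_def mult.commute
        pdiff_commute[OF u S] intro!: sum.cong)
  ultimately show ?thesis unfolding grad_def[abs_def] by simp
qed

lemma bounded_bilinear_bdot_cvec: "bounded_bilinear (\<lambda>v w. bdot (cvec v) w)"
proof (rule bilinear_conv_bounded_bilinear[THEN iffD1])
  show "bilinear (\<lambda>v w. bdot (cvec v) w)"
    unfolding bilinear_def
    by (auto intro!: linearI simp: bdot_def cvec_def sum.distrib ring_distribs sum_distrib_left scaleR_conv_of_real[where 'a = complex] mult_ac)
qed

text \<open>
  The product rule for \<open>\<nu> \<cdot> \<nabla>u\<close>: the variation of \<open>a \<times> m\<close> is projected orthogonally to \<open>\<nu>\<close> and
  divided by \<open>norm (a \<times> m)\<close>, and the variation of the gradient is the Hessian.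
\<close>

lemma has_derivative_normal_trace:
  assumes u: "C2_on S u" and S: "open S" and w: "w \<in> jet_domain S"
  shows "(normal_trace u has_derivative normal_trace_deriv u w) (at w)"
proof -
  obtain x a m where w_eq: "w = (x, a, m)" by (cases w)
  have x: "x \<in> S" and N: "cross3 a m \<noteq> 0" using w by (auto simp: jet_domain_def w_eq)
  let ?N = "\<lambda>w::jet. cross3 (fst (snd w)) (snd (snd w))"
  have N': "(?N has_derivative (\<lambda>(y, b, l). cross3 a l + cross3 b m)) (at w)"
    unfolding case_prod_unfold
    by (rule has_derivative_eq_rhs[OF bounded_bilinear.FDERIV[OF cross3_bounded_bilinear,
          where f' = "\<lambda>v. fst (snd v)" and g' = "\<lambda>v. snd (snd v)"]])
       (auto simp: w_eq intro!: derivative_intros)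
  have "?N w \<noteq> 0" using N by (simp add: w_eq)
  note nu = has_derivative_compose[OF N' has_derivative_sgn[OF this]]
  have x': "((\<lambda>w. grad u (fst w)) has_derivative (\<lambda>v. hess u x *v cvec (fst v))) (at w)"
    by (rule has_derivative_compose[of fst fst w UNIV "grad u"])
       (auto intro!: derivative_intros simp: w_eq has_derivative_grad[OF u S x])
  have "((\<lambda>w. bdot (cvec (sgn (?N w))) (grad u (fst w))) has_derivative normal_trace_deriv u w) (at w)"
    by (rule has_derivative_eq_rhs[OF bounded_bilinear.FDERIV[OF bounded_bilinear_bdot_cvec nu x']])
       (auto simp: fun_eq_iff normal_trace_deriv_def w_eq Let_def projection_mult_vec add.commute
         bounded_bilinear.scaleR_left[OF bounded_bilinear_bdot_cvec]
         scaleR_conv_of_real[where 'a = complex])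
  then show ?thesis by (simp add: normal_trace_def case_prod_unfold)
qed

lemma continuous_on_grad: "C2_on S u \<Longrightarrow> continuous_on S (grad u)"
  unfolding grad_def[abs_def] by (intro continuous_on_vec_lambda C2_onD)

lemma continuous_on_normal_trace:
  assumes u: "C2_on S u" and S: "open S"
  shows "continuous_on (jet_domain S) (normal_trace u)"
  using has_derivative_normal_trace[OF u S] has_derivative_continuous_on has_derivative_at_withinI by metis

lemma continuous_on_normal_trace_deriv:
  assumes u: "C2_on S u"
  shows "continuous_on (jet_domain S) (\<lambda>w. normal_trace_deriv u w v)"
proof -
  obtain y b l where v: "v = (y, b, l)" by (cases v)
  have proj: "fst ` jet_domain S \<subseteq> S" by (auto simp: jet_domain_def)
  have g: "continuous_on (jet_domain S) (\<lambda>w. grad u (fst w))"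
    by (rule continuous_on_compose2[OF continuous_on_grad[OF u] continuous_on_fst[OF continuous_on_id] proj])
  have "continuous_on S (\<lambda>x. hess u x *v cvec y)"
    unfolding matrix_vector_mult_def hess_def
    by (auto intro!: continuous_intros C2_onD(4)[OF u])
  then have h: "continuous_on (jet_domain S) (\<lambda>w. hess u (fst w) *v cvec y)"
    by (rule continuous_on_compose2[OF _ continuous_on_fst[OF continuous_on_id] proj])
  let ?N = "\<lambda>w::jet. cross3 (fst (snd w)) (snd (snd w))"
  have N: "continuous_on (jet_domain S) ?N" by (intro continuous_on_cross continuous_intros)
  have N0: "\<And>w. w \<in> jet_domain S \<Longrightarrow> ?N w \<noteq> 0" by (auto simp: jet_domain_def)
  have nu: "continuous_on (jet_domain S) (\<lambda>w. sgn (?N w))"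
    using N N0 by (auto intro!: continuous_intros)
  have Nv: "continuous_on (jet_domain S) (\<lambda>w. cross3 b (snd (snd w)) + cross3 (fst (snd w)) l)"
    by (intro continuous_on_cross continuous_intros)
  have "continuous_on (jet_domain S) (\<lambda>w. complex_of_real (1 / norm (?N w)) *
       bdot (cvec ((mat 1 - outer (sgn (?N w)) (sgn (?N w))) *v (cross3 b (snd (snd w)) + cross3 (fst (snd w)) l))) (grad u (fst w))
     + bdot (cvec (sgn (?N w))) (hess u (fst w) *v cvec y))"
    unfolding projection_mult_vec
    using N N0 by (intro continuous_intros bounded_bilinear.continuous_on[OF bounded_bilinear_bdot_cvec] Nv nu g h) auto
  then show ?thesis by (simp add: normal_trace_deriv_def case_prod_unfold Let_def v)
qed

section \<open>Surfaces and their blown-up jets\<close>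

text \<open>
  The first-order jet of \<open>h\<close> with \<open>h\<^sub>\<phi>\<close> replaced by its quotient, which does not degenerate at collapsed
  sides.
\<close>

definition blowup_jet :: "real set \<Rightarrow> (real \<times> real \<Rightarrow> real ^ 3) \<Rightarrow> real \<times> real \<Rightarrow> jet" where
  "blowup_jet E h p = (h p, dtheta h p, dphi_quot E h p)"

lemma open_exterior: "open (exterior D)"
  by (simp add: exterior_def open_Compl)

lemma surfaces_in_C2_space: "w \<in> surfaces D E \<Longrightarrow> w \<in> C2_space E"
  by (simp add: surfaces_def)

lemma unit_normal_eq_sgn: "unit_normal w p = sgn (nvec w p)"
  by (simp add: unit_normal_def sgn_div_norm)

text \<open>
  At a degenerate point of a collapsed side the limit defining the extension is taken over the
  complement of the collapsed sides, which accumulates at the side; there it is the limit of the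
  continuous \<open>g\<close>.
\<close>

lemma cont_ext_eqI:
  assumes E: "E \<subseteq> {0, pi}"
    and nvec: "\<And>p. p \<in> rect \<Longrightarrow> nvec w p \<noteq> 0 \<longleftrightarrow> fst p \<notin> E"
    and fg: "\<And>p. p \<in> rect \<Longrightarrow> fst p \<notin> E \<Longrightarrow> f p = g p"
    and g: "continuous_on rect g" and p: "p \<in> rect"
  shows "cont_ext w f p = g p"
proof (cases "fst p \<in> E")
  case False
  then show ?thesis using nvec[OF p] fg[OF p] by (simp add: cont_ext_def)
next
  case True
  let ?S = "{q \<in> rect. nvec w q \<noteq> 0}"
  have "p islimpt ?S"
    unfolding islimpt_approachable
  proof (intro allI impI)
    fix d :: real assume d: "d > 0"
    \<comment> \<open>A step into the rectangle: \<open>cos\<close> is 1 at 0 and -1 at \<open>pi\<close>, and \<open>s < 1 < pi\<close> keeps off the opposite side.\<close>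
    define s where "s = min d 1 / 2"
    define q where "q = (fst p + cos (fst p) * s, snd p)"
    have s: "0 < s" "s < d" "s < 1" using d by (auto simp: s_def min_def)
    have pi1: "1 < pi" using pi_gt3 by simp
    have "fst p = 0 \<or> fst p = pi" using True E by auto
    then have "q \<in> rect" "fst q \<notin> E" "q \<noteq> p" "dist q p < d"
      using s p E pi1 by (auto simp: q_def rect_iff dist_prod_def dist_real_def prod_eq_iff)
    then show "\<exists>q\<in>?S. q \<noteq> p \<and> dist q p < d"
      using nvec by blast
  qed
  then have nontriv: "at p within ?S \<noteq> bot" by (simp add: trivial_limit_within)
  have "(g \<longlongrightarrow> g p) (at p within ?S)"
    using g p unfolding continuous_on_def by (blast intro: tendsto_within_subset)
  then have "(f \<longlongrightarrow> g p) (at p within ?S)"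
    by (rule Lim_transform_eventually) (rule eventually_at_topological[THEN iffD2], use nvec fg in \<open>auto intro!: exI[of _ UNIV]\<close>)
  then have "Lim (at p within ?S) f = g p" by (rule tendsto_Lim[OF nontriv])
  then show ?thesis using nvec[OF p] True by (simp add: cont_ext_def)
qed

context
  fixes E :: "real set"
  assumes E: "E \<subseteq> {0, pi}"
begin

lemma blowup_jet_lincomb:
  assumes f: "f \<in> C2_space E" and g: "g \<in> C2_space E" and p: "p \<in> rect"
  shows "blowup_jet E (\<lambda>p. a *\<^sub>R f p + b *\<^sub>R g p) p = a *\<^sub>R blowup_jet E f p + b *\<^sub>R blowup_jet E g p"
  using C1_rect_lincomb(2)[OF C2_rect_D(1)[OF C2_spaceD(1)[OF f]] C2_rect_D(1)[OF C2_spaceD(1)[OF g]] refl p]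
    dphi_quot_lincomb[OF E C2_spaceD(1)[OF f] C2_spaceD(1)[OF g] p]
  by (simp add: blowup_jet_def)

lemma continuous_blowup_jet:
  assumes "h \<in> C2_space E"
  shows "continuous_on rect (blowup_jet E h)"
  unfolding blowup_jet_def
  using C1_rect_continuous[OF C2_rect_D(1)[OF C2_spaceD(1)[OF assms]]] continuous_dphi_quot[OF E C2_spaceD(1)[OF assms]]
  by (intro continuous_intros)

lemma norm_blowup_jet_le:
  assumes h: "h \<in> C2_space E" and p: "p \<in> rect"
  shows "norm (blowup_jet E h p) \<le> (3 + card E) * C2_norm h"
proof -
  note H = C2_spaceD(1)[OF h]
  have "norm (blowup_jet E h p) \<le> norm (h p) + (norm (dtheta h p) + norm (dphi_quot E h p))"
    unfolding blowup_jet_def by (intro order.trans[OF norm_Pair_le] add_left_mono norm_Pair_le)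
  also have "\<dots> \<le> C2_norm h + (C2_norm h + (1 + card E) * C2_norm h)"
    by (intro add_mono norm_le_C2_norm norm_dphi_quot_le E H p)
  finally show ?thesis by (simp add: algebra_simps)
qed

lemma dphi_quot_weight_pos:
  "1 + (\<Sum>e\<in>E. 1 / \<bar>s - e\<bar>) > (0::real)"
  by (intro add_pos_nonneg sum_nonneg) auto

text \<open>
  One factor \<open>r\<close> serves all \<open>h\<close>; it therefore cancels in the normal, and in the derivative
  between \<open>norm (nvec w p)\<close> and the varied cross product.
\<close>

lemma dphi_eq_scaled_dphi_quot:
  assumes p: "p \<in> rect" "fst p \<notin> E"
  obtains r where "r > 0"
    "\<And>h. h \<in> C2_space E \<Longrightarrow> dphi h p = r *\<^sub>R dphi_quot E h p"
proof -
  define r where "r = 1 + (\<Sum>e\<in>E. 1 / \<bar>fst p - e\<bar>)"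
  have r: "r > 0" using dphi_quot_weight_pos by (simp add: r_def)
  show thesis
  proof (rule that[of "1 / r"])
    show "dphi h p = (1 / r) *\<^sub>R dphi_quot E h p" if "h \<in> C2_space E" for h
      using dphi_quot_regular_side[OF E that p] r by (simp flip: r_def)
  qed (use r in simp)
qed

text \<open>
  The two clauses of \<open>regular\<close> become one: the quotient is a positive multiple of \<open>w\<^sub>\<phi>\<close> off the
  collapsed sides and \<open>\<plusminus>\<partial>w\<^sub>\<phi>/\<partial>\<theta>\<close> on them.
\<close>

lemma surfaces_iff_blowup_jet:
  assumes w: "w \<in> C2_space E"
  shows "w \<in> surfaces D E \<longleftrightarrow> blowup_jet E w ` rect \<subseteq> jet_domain (exterior D)"
proof -
  have "(if fst p \<in> E then cross3 (dtheta w p) (dtheta (dphi w) p) \<noteq> 0 else nvec w p \<noteq> 0)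
      \<longleftrightarrow> cross3 (dtheta w p) (dphi_quot E w p) \<noteq> 0" if p: "p \<in> rect" for p
  proof (cases "fst p \<in> E")
    case True
    then have "cos (fst p) \<noteq> 0" using E by auto
    then show ?thesis
      using True dphi_quot_collapsed_side[OF E w p True] by (simp add: cross_mult_right)
  next
    case False
    then show ?thesis
      using dphi_quot_regular_side[OF E w p False] dphi_quot_weight_pos[of "fst p"]
      by (simp add: nvec_def cross_mult_right)
  qed
  then show ?thesis
    using w by (auto simp: surfaces_def regular_def jet_domain_def blowup_jet_def)
qed

lemma blowup_jet_in_jet_domain:
  assumes w: "w \<in> surfaces D E" and p: "p \<in> rect"
  shows "blowup_jet E w p \<in> jet_domain (exterior D)"
  using surfaces_iff_blowup_jet[OF surfaces_in_C2_space[OF w]] w p by blast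

lemma nvec_nonzero_iff:
  assumes w: "w \<in> surfaces D E" and p: "p \<in> rect"
  shows "nvec w p \<noteq> 0 \<longleftrightarrow> fst p \<notin> E"
  using w p C2_spaceD(2)[OF surfaces_in_C2_space[OF w] p]
  by (auto simp: surfaces_def regular_def nvec_def split: if_splits dest!: bspec)

context
  fixes D :: "(real ^ 3) set" and u :: "real ^ 3 \<Rightarrow> complex" and w :: "real \<times> real \<Rightarrow> real ^ 3"
  assumes u: "C2_on (exterior D) u" and w: "w \<in> surfaces D E"
begin

text \<open>
  Expanding in a basis separates the two jets, so that continuity of the derivative in its base point,
  for each fixed direction, is enough.
\<close>

lemma continuous_normal_trace_deriv_jet:
  assumes h: "h \<in> C2_space E"
  shows "continuous_on rect (\<lambda>p. normal_trace_deriv u (blowup_jet E w p) (blowup_jet E h p))"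
proof -
  have "continuous_on rect (\<lambda>p. \<Sum>i\<in>Basis. (blowup_jet E h p \<bullet> i) *\<^sub>R normal_trace_deriv u (blowup_jet E w p) i)"
    using blowup_jet_in_jet_domain[OF w]
    by (intro continuous_intros continuous_blowup_jet h surfaces_in_C2_space[OF w]
        continuous_on_compose2[OF continuous_on_normal_trace_deriv[OF u]]) auto
  moreover have "normal_trace_deriv u (blowup_jet E w p) (blowup_jet E h p)
      = (\<Sum>i\<in>Basis. (blowup_jet E h p \<bullet> i) *\<^sub>R normal_trace_deriv u (blowup_jet E w p) i)" if "p \<in> rect" for p
    by (rule linear_eq_sum_Basis[OF has_derivative_linear[OF has_derivative_normal_trace[OF u open_exterior blowup_jet_in_jet_domain[OF w that]]]])
  ultimately show ?thesis by (simp cong: continuous_on_cong)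
qed

lemma continuous_normal_trace_jet: "continuous_on rect (\<lambda>p. normal_trace u (blowup_jet E w p))"
  using blowup_jet_in_jet_domain[OF w]
  by (intro continuous_on_compose2[OF continuous_on_normal_trace[OF u open_exterior] continuous_blowup_jet] surfaces_in_C2_space[OF w]) auto

lemma G_eq_normal_trace:
  assumes p: "p \<in> rect"
  shows "G u w p = normal_trace u (blowup_jet E w p)"
  unfolding G_def
proof (rule cont_ext_eqI[OF E nvec_nonzero_iff[OF w] _ continuous_normal_trace_jet p])
  fix q assume q: "q \<in> rect" "fst q \<notin> E"
  obtain r where r: "r > 0" "\<And>h. h \<in> C2_space E \<Longrightarrow> dphi h q = r *\<^sub>R dphi_quot E h q"
    using dphi_eq_scaled_dphi_quot[OF q] by blast
  show "bdot (cvec (unit_normal w q)) (grad u (w q)) = normal_trace u (blowup_jet E w q)"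
    using r(1) by (simp add: normal_trace_def blowup_jet_def unit_normal_eq_sgn nvec_def r(2)[OF surfaces_in_C2_space[OF w]]
        cross_mult_right sgn_scaleR)
qed

lemma G_deriv_eq_normal_trace_deriv:
  assumes h: "h \<in> C2_space E" and p: "p \<in> rect"
  shows "G_deriv u w h p = normal_trace_deriv u (blowup_jet E w p) (blowup_jet E h p)"
  unfolding G_deriv_def
proof (rule cont_ext_eqI[OF E nvec_nonzero_iff[OF w] _ continuous_normal_trace_deriv_jet[OF h] p])
  fix q assume q: "q \<in> rect" "fst q \<notin> E"
  obtain r where r: "r > 0" "\<And>h. h \<in> C2_space E \<Longrightarrow> dphi h q = r *\<^sub>R dphi_quot E h q"
    using dphi_eq_scaled_dphi_quot[OF q] by blast
  let ?N = "cross3 (dtheta w q) (dphi_quot E w q)"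
  let ?L = "cross3 (dtheta h q) (dphi_quot E w q) + cross3 (dtheta w q) (dphi_quot E h q)"
  have N: "nvec w q = r *\<^sub>R ?N"
    by (simp add: nvec_def r(2)[OF surfaces_in_C2_space[OF w]] cross_mult_right)
  then have nu: "unit_normal w q = sgn ?N"
    using r(1) by (simp add: unit_normal_eq_sgn sgn_scaleR)
  have L: "cross3 (dtheta h q) (dphi w q) + cross3 (dtheta w q) (dphi h q) = r *\<^sub>R ?L"
    by (simp add: r(2)[OF surfaces_in_C2_space[OF w]] r(2)[OF h] cross_mult_right scaleR_add_right)
  have "complex_of_real (1 / norm (r *\<^sub>R ?N)) * bdot (cvec ((mat 1 - outer (sgn ?N) (sgn ?N)) *v (r *\<^sub>R ?L))) v
      = complex_of_real (1 / norm ?N) * bdot (cvec ((mat 1 - outer (sgn ?N) (sgn ?N)) *v ?L)) v" for v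
    using r(1)
    by (simp add: bounded_bilinear.scaleR_left[OF bounded_bilinear_bdot_cvec] matrix_vector_mult_scaleR
        scaleR_conv_of_real[where 'a = complex])
  then show "complex_of_real (1 / norm (nvec w q)) *
       bdot (cvec ((mat 1 - outer (unit_normal w q) (unit_normal w q)) *v
                   (cross3 (dtheta h q) (dphi w q) + cross3 (dtheta w q) (dphi h q))))
            (grad u (w q))
     + bdot (cvec (unit_normal w q)) (hess u (w q) *v cvec (h q))
     = normal_trace_deriv u (blowup_jet E w q) (blowup_jet E h q)"
    unfolding N nu L by (simp add: normal_trace_deriv_def blowup_jet_def Let_def)
qed

end

end

section \<open>The Frechet derivative\<close>

theorem theorem3p2:
  fixes D :: "(real ^ 3) set" and k :: real and d :: "real ^ 3"
    and u :: "real ^ 3 \<Rightarrow> complex"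
    and E :: "real set" and z :: "real \<times> real \<Rightarrow> real ^ 3"
  assumes "bounded_lipschitz_domain D" and "connected (exterior D)"
    and "k > 0" and "norm d = 1"
    and "total_field D k d u"
    and "E \<subseteq> {0, pi}"
    and "z \<in> surfaces D E" and "closed_surface z"
  shows "frechet_at (C2_space E) (surfaces D E) (G u) (G_deriv u z) z"
proof -
  note E = \<open>E \<subseteq> {0, pi}\<close> and z = \<open>z \<in> surfaces D E\<close>
  have u: "C2_on (exterior D) u" using \<open>total_field D k d u\<close> by (simp add: total_field_def)
  let ?U = "jet_domain (exterior D)" and ?J = "blowup_jet E" and ?\<Phi>' = "normal_trace_deriv u"
  let ?K = "?J z ` rect"
  note zX = surfaces_in_C2_space[OF z]
  have U: "open ?U" by (rule open_jet_domain[OF open_exterior])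
  have K: "compact ?K" by (intro compact_continuous_image continuous_blowup_jet E zX compact_rect)
  have KU: "?K \<subseteq> ?U" using blowup_jet_in_jet_domain[OF E z] by blast
  note der = has_derivative_normal_trace[OF u open_exterior]
  note cont = continuous_on_normal_trace_deriv[OF u]
  have lin: "linear (?\<Phi>' (?J z p))" if "p \<in> rect" for p
    using der KU that has_derivative_linear by blast
  define C where "C = real (3 + card E)"
  have C: "C > 0" by (simp add: C_def)
  have J_le: "norm (?J h p) \<le> C * C2_norm h" if "h \<in> C2_space E" "p \<in> rect" for h p
    using norm_blowup_jet_le[OF E that] by (simp add: C_def)
  have J_add: "?J (\<lambda>q. f q + g q) p = ?J f p + ?J g p"
    and X_add: "(\<lambda>q. f q + g q) \<in> C2_space E"
    if "f \<in> C2_space E" "g \<in> C2_space E" "p \<in> rect" for f g p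
    using blowup_jet_lincomb[OF E that, of 1 1] C2_space_lincomb[OF that(1,2), of 1 1] by simp_all
  have J_scale: "?J (\<lambda>q. c *\<^sub>R f q) p = c *\<^sub>R ?J f p" and X_scale: "(\<lambda>q. c *\<^sub>R f q) \<in> C2_space E"
    if "f \<in> C2_space E" "p \<in> rect" for c f p
    using blowup_jet_lincomb[OF E that(1) that(1) that(2), of c 0] C2_space_lincomb[OF that(1,1), of c 0] by simp_all
  have nonneg: "0 \<le> C2_norm h" if "h \<in> C2_space E" for h
    using C2_norm_nonneg C2_spaceD(1)[OF that] .
  \<comment> \<open>The remainder estimate at a point needs the perturbed jet to stay in \<open>?U\<close>; membership in \<open>surfaces D E\<close> is the same condition at all points, so both come from one \<open>\<delta>\<close>.\<close>
  have expansion: "\<exists>\<delta>>0. \<forall>h\<in>C2_space E. C2_norm h < \<delta> \<longrightarrow> (\<lambda>p. z p + h p) \<in> surfaces D E \<and>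
        sup_norm (\<lambda>p. G u (\<lambda>q. z q + h q) p - G u z p - G_deriv u z h p) \<le> \<epsilon> * C2_norm h"
    if \<epsilon>: "\<epsilon> > 0" for \<epsilon>
  proof -
    \<comment> \<open>The expansion of \<open>normal_trace u\<close> is measured by the jet of \<open>h\<close>, of norm at most \<open>C * C2_norm h\<close>.\<close>
    have "\<epsilon> / C > 0" using \<epsilon> C by simp
    from uniform_first_order_expansion[OF U K KU der cont this]
    obtain \<eta> where \<eta>: "\<eta> > 0" "\<And>x y. x \<in> ?K \<Longrightarrow> norm y < \<eta> \<Longrightarrow> x + y \<in> ?U"
      "\<And>x y. x \<in> ?K \<Longrightarrow> norm y < \<eta> \<Longrightarrow>
        norm (normal_trace u (x + y) - normal_trace u x - ?\<Phi>' x y) \<le> \<epsilon> / C * norm y"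
      by blast
    show ?thesis
    proof (intro exI[of _ "\<eta> / C"] conjI ballI impI)
      show "\<eta> / C > 0" using \<eta> C by simp
    next
      fix h assume h: "h \<in> C2_space E" and small: "C2_norm h < \<eta> / C"
      have zh: "(\<lambda>q. z q + h q) \<in> C2_space E" by (rule X_add[OF zX h zero_in_rect])
      have J_small: "norm (?J h p) < \<eta>" if "p \<in> rect" for p
        using J_le[OF h that] small C by (simp add: pos_less_divide_eq mult.commute)
      show in_surfaces: "(\<lambda>p. z p + h p) \<in> surfaces D E"
        unfolding surfaces_iff_blowup_jet[OF E zh]
      proof (rule image_subsetI)
        fix p assume p: "p \<in> rect"
        show "?J (\<lambda>p. z p + h p) p \<in> ?U"
          using \<eta>(2)[OF imageI[OF p] J_small[OF p]] by (simp add: J_add[OF zX h p])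
      qed
      show "sup_norm (\<lambda>p. G u (\<lambda>q. z q + h q) p - G u z p - G_deriv u z h p) \<le> \<epsilon> * C2_norm h"
      proof (rule sup_norm_le)
        fix p assume p: "p \<in> rect"
        have "norm (G u (\<lambda>q. z q + h q) p - G u z p - G_deriv u z h p) \<le> \<epsilon> / C * norm (?J h p)"
          using \<eta>(3)[OF _ J_small[OF p], of "?J z p"] p
          by (simp add: G_eq_normal_trace[OF E u in_surfaces p] G_eq_normal_trace[OF E u z p]
              G_deriv_eq_normal_trace_deriv[OF E u z h p] J_add[OF zX h p])
        also have "\<dots> \<le> \<epsilon> / C * (C * C2_norm h)"
          using \<epsilon> C by (intro mult_left_mono J_le h p) simp
        finally show "norm (G u (\<lambda>q. z q + h q) p - G u z p - G_deriv u z h p) \<le> \<epsilon> * C2_norm h"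
          using C by simp
      qed
    qed
  qed
  obtain B where B: "B \<ge> 0" "\<And>x y. x \<in> ?K \<Longrightarrow> norm (?\<Phi>' x y) \<le> B * norm y"
    by (rule derivative_bounded_on_compact[OF K, of ?\<Phi>'])
       (use lin continuous_on_subset[OF cont KU] in auto)
  note G_deriv = G_deriv_eq_normal_trace_deriv[OF E u z]
  show ?thesis
    unfolding frechet_at_def
  proof (intro conjI ballI allI impI)
    show "z \<in> surfaces D E" by (rule z)
    show "\<exists>\<delta>>0. \<forall>h\<in>C2_space E. C2_norm h < \<delta> \<longrightarrow> (\<lambda>p. z p + h p) \<in> surfaces D E"
      using expansion[of 1] by auto
    show "continuous_on rect (G u w)" if "w \<in> surfaces D E" for w
      using continuous_normal_trace_jet[OF E u that] G_eq_normal_trace[OF E u that]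
      by (simp cong: continuous_on_cong)
    show "continuous_on rect (G_deriv u z h)" if "h \<in> C2_space E" for h
      using continuous_normal_trace_deriv_jet[OF E u z that] G_deriv[OF that]
      by (simp cong: continuous_on_cong)
    show "G_deriv u z (\<lambda>q. h q + h' q) p = G_deriv u z h p + G_deriv u z h' p"
      if "h \<in> C2_space E" "h' \<in> C2_space E" "p \<in> rect" for h h' p
      using that by (simp add: G_deriv X_add J_add linear_add[OF lin])
    show "G_deriv u z (\<lambda>q. c *\<^sub>R h q) p = c *\<^sub>R G_deriv u z h p"
      if "h \<in> C2_space E" "p \<in> rect" for h c p
      using that by (simp add: G_deriv X_scale J_scale linear_scale[OF lin])
    show "\<exists>B. \<forall>h\<in>C2_space E. sup_norm (G_deriv u z h) \<le> B * C2_norm h"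
    proof (intro exI[of _ "B * C"] ballI sup_norm_le)
      fix h p assume h: "h \<in> C2_space E" and p: "p \<in> rect"
      have "norm (G_deriv u z h p) \<le> B * norm (?J h p)"
        using B(2) p by (simp add: G_deriv h)
      also have "\<dots> \<le> B * (C * C2_norm h)" using B(1) by (intro mult_left_mono J_le h p)
      finally show "norm (G_deriv u z h p) \<le> B * C * C2_norm h" by (simp add: mult.assoc)
    qed
    show "\<exists>\<delta>>0. \<forall>h\<in>C2_space E. C2_norm h < \<delta> \<longrightarrow>
        sup_norm (\<lambda>p. G u (\<lambda>q. z q + h q) p - G u z p - G_deriv u z h p) \<le> \<epsilon> * C2_norm h"
      if "\<epsilon> > 0" for \<epsilon>
      using expansion[OF that] by blast
  qed
qed

end
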